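(* Let $\mathbf{D}=[\mathbf{d}_0|\dots|\mathbf{d}_{P-1}]\in\mathbb{C}^{L\times P}$ be a finite dictionary with normalized atoms, $\|\mathbf{d}_p\|_2=1$ for all $p$, whose atoms span $\mathbb{C}^L$, with $$\lambda_{\min}:=\inf_{\mathbf{y}\in\mathbb{C}^L,\ \|\mathbf{y}\|_2=1}\ \max_p|\langle\mathbf{y},\mathbf{d}_p\rangle|^2>0,$$ and let $\mathbf{x}\in\mathbb{R}^L$ be a signal. Fix some $\epsilon>0$, and fix $0<\delta<1/2$ and $0<\varepsilon<1-2\delta$ such that $\frac{2\delta}{1-(2\delta+\varepsilon)}<\sqrt{\lambda_{\min}}$. If approximate coefficient-domain matching pursuit with reset (as defined in the context) is initialized on $\mathbf{x}$ with the truncated Gram matrix $\mathbf{G}_\epsilon$, its stopping criterion includes the condition $E^{\mathrm{out}}\le E\,\|\mathbf{x}\|_2^2$ for some $0<E<1$, and its reset criterion includes the conditions $$|\boldsymbol{\varrho}_k(p_{k+1})|<\frac{\epsilon}{\delta}\sum_{l=k^{\mathrm{out}}+1}^{k}|\boldsymbol{\varrho}_{l-1}(p_l)|,\qquad |\boldsymbol{\varrho}_k(p_{k+1})|<\frac{2\delta\,\bigl(1-\varepsilon(1+\delta)^{-2}\lambda_{\min}\bigr)^{\frac{k^{\mathrm{out}}-k}{2}}}{1-(2\delta+\varepsilon)}\,\|\mathbf{r}^{\mathrm{out}}\|_2$$ and $$k>\frac{\log(E)}{\log\bigl(1-\varepsilon(1+\delta)^{-2}\lambda_{\min}\bigr)},$$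 then the algorithm terminates after a finite number of total selection steps, achieving the desired approximation error $E^{\mathrm{out}}\le E\,\|\mathbf{x}\|_2^2$.
   Context: The inner product on $\mathbb{C}^L$ is $\langle \mathbf{x},\mathbf{y}\rangle=\mathbf{y}^*\mathbf{x}=\sum_l \mathbf{x}(l)\overline{\mathbf{y}(l)}$ and $\|\cdot\|_2$ is the induced norm; real vectors are regarded as elements of $\mathbb{C}^L$. The Gram matrix is $\mathbf{G}=\mathbf{D}^*\mathbf{D}$, $\mathbf{G}(k,j)=\langle\mathbf{d}_j,\mathbf{d}_k\rangle$. The truncated Gram matrix $\mathbf{G}_\epsilon$ is given by $\mathbf{G}_\epsilon(k,j)=\mathbf{G}(k,j)$ if $|\mathbf{G}(k,j)|>\epsilon$ and $\mathbf{G}_\epsilon(k,j)=0$ otherwise. $\mathbf{G}_\epsilon(\bullet,p)$ denotes the $p$-th column, and $\mathbf{e}_p\in\mathbb{C}^P$ the $p$-th standard unit vector. Approximate coefficient-domain matching pursuit with reset. The counter $k\ge 0$ is the total number of selection steps performed so far, $\mathbf{c}_k\in\mathbb{C}^P$ is the total coefficient vector accumulated after $k$ selection steps ($\mathbf{c}_0=\mathbf{0}$), and $\mathbf{r}_k=\mathbf{x}-\mathbf{D}\mathbf{c}_k$ is the true residual. $k^{\mathrm{out}}$ is the value of $k$ at the most recent reset (initially $k^{\mathrm{out}}=0$), $\mathbf{r}^{\mathrm{out}}=\mathbf{r}_{k^{\mathrm{out}}}$ (initially $\mathbf{r}^{\mathrm{out}}=\mathbf{x}$), and $E^{\mathrm{out}}=\|\mathbf{r}^{\mathrm{out}}\|_2^2$.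 The algorithm consists of passes (an outer loop). A pass is started as long as the stopping criterion is not met; otherwise the algorithm terminates with output $\mathbf{c}_{k^{\mathrm{out}}}$. At the start of a pass, the coefficient-domain residual is (re)initialized exactly: $\boldsymbol{\varrho}_k:=\mathbf{D}^*\mathbf{r}^{\mathrm{out}}=\mathbf{D}^*(\mathbf{x}-\mathbf{D}\mathbf{c}_k)$ with $k=k^{\mathrm{out}}$. Within a pass (inner loop), as long as the reset criterion is not met, a selection step is performed: $$p_{k+1}=\operatorname{argmax}_p|\boldsymbol{\varrho}_k(p)|,\quad \mathbf{c}_{k+1}=\mathbf{c}_k+\boldsymbol{\varrho}_k(p_{k+1})\mathbf{e}_{p_{k+1}},\quad \boldsymbol{\varrho}_{k+1}=\boldsymbol{\varrho}_k-\boldsymbol{\varrho}_k(p_{k+1})\,\mathbf{G}_\epsilon(\bullet,p_{k+1}),$$ and then $k$ is increased by one. The reset criterion is evaluated before each selection step, using the current $\boldsymbol{\varrho}_k$ and its maximizing index $p_{k+1}$; if it is met, the pass ends without performing that step, and $k^{\mathrm{out}}:=k$, $\mathbf{r}^{\mathrm{out}}:=\mathbf{r}_k$, $E^{\mathrm{out}}:=\|\mathbf{r}_k\|_2^2$ are updated (this is a reset). When the reset criterion is triggered in the $(k+1)$-th selection step, $\boldsymbol{\varrho}_k$ henceforth denotes the reinitialized vector $\mathbf{D}^*(\mathbf{x}-\mathbf{D}\mathbf{c}_k)$. Both the stopping and the reset criterion may consist of any number of conditions, and the corresponding loop is terminated if any one of its conditions is met. Empty sums are zero.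
   Formalization: Any additional reset condition is assumed not to be met at the start of a pass, before a selection step since the last reset (else endless empty passes are possible); the error bound is claimed only when no additional stopping condition is met at termination (else it may stop too early). *)

theory Defs
  imports "HOL-Analysis.Analysis"
begin

text \<open>A vector of \<open>complex ^ 'l\<close> carries the norm \<open>L2_set\<close> of the moduli of its entries, i.e. the
  norm induced by the inner product below, which is linear in the first argument.\<close>

definition cinner :: "complex ^ 'l \<Rightarrow> complex ^ 'l \<Rightarrow> complex" where
  "cinner x y = (\<Sum>l\<in>UNIV. x $ l * cnj (y $ l))"

definition adjoint_matrix :: "complex ^ 'p ^ 'l \<Rightarrow> complex ^ 'l ^ 'p" where
  "adjoint_matrix D = (\<chi> p l. cnj (D $ l $ p))"

definition complex_vec :: "real ^ 'l \<Rightarrow> complex ^ 'l" where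
  "complex_vec x = (\<chi> l. complex_of_real (x $ l))"

definition gram :: "complex ^ 'p ^ 'l \<Rightarrow> complex ^ 'p ^ 'p" where
  "gram D = adjoint_matrix D ** D"

definition truncated_gram :: "real \<Rightarrow> complex ^ 'p ^ 'l \<Rightarrow> complex ^ 'p ^ 'p" where
  "truncated_gram \<epsilon> D =
     (\<chi> k j. if cmod (gram D $ k $ j) > \<epsilon> then gram D $ k $ j else 0)"

definition lambda_min :: "complex ^ 'p ^ 'l \<Rightarrow> real" where
  "lambda_min D =
     (INF y\<in>{y. norm y = 1}. Max (range (\<lambda>p. (cmod (cinner y (column p D)))\<^sup>2)))"

text \<open>A state of the algorithm, with its whole history. The sequences are meaningful only up to
  the current counter: \<open>coeff s k\<close> and \<open>rho s k\<close> for \<open>k \<le> steps s\<close>, and \<open>sel s k\<close> for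
  \<open>1 \<le> k \<le> steps s\<close>. The value \<open>reset_at s\<close> is the counter at the most recent reset.
  The flag \<open>in_pass s\<close> distinguishes the head of the inner loop from that of the outer loop.\<close>

record ('p::finite) mp_state =
  in_pass :: bool
  steps :: nat
  reset_at :: nat
  sel :: "nat \<Rightarrow> 'p"
  coeff :: "nat \<Rightarrow> complex ^ 'p"
  rho :: "nat \<Rightarrow> complex ^ 'p"

type_synonym 'p stop_condition = "'p mp_state \<Rightarrow> bool"

text \<open>A reset condition may also refer to the index that maximises the current coefficient-domain
  residual, which has not been recorded in the state when the condition is evaluated.\<close>

type_synonym 'p reset_condition = "'p mp_state \<Rightarrow> 'p \<Rightarrow> bool"

definition mp_init :: "('p::finite) mp_state" where
  "mp_init = \<lparr>in_pass = False, steps = 0, reset_at = 0, sel = (\<lambda>_. undefined),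
     coeff = (\<lambda>_. 0), rho = (\<lambda>_. 0)\<rparr>"

definition r_out :: "complex ^ 'p ^ 'l \<Rightarrow> complex ^ 'l \<Rightarrow> 'p mp_state \<Rightarrow> complex ^ 'l" where
  "r_out D x s = x - D *v coeff s (reset_at s)"

definition E_out :: "complex ^ 'p ^ 'l \<Rightarrow> complex ^ 'l \<Rightarrow> 'p mp_state \<Rightarrow> real" where
  "E_out D x s = (norm (r_out D x s))\<^sup>2"

definition maximizes :: "('p::finite) mp_state \<Rightarrow> 'p \<Rightarrow> bool" where
  "maximizes s p \<longleftrightarrow> is_arg_max (\<lambda>q. cmod (rho s (steps s) $ q)) (\<lambda>_. True) p"

text \<open>One transition of the algorithm run on \<open>x\<close> with the matrix \<open>H\<close> in place of the Gram matrix.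
  Ties between maximising indices are resolved nondeterministically, so that all tie-breaking
  rules are covered.\<close>

inductive mp_step ::
  "complex ^ 'p ^ 'l \<Rightarrow> complex ^ 'l \<Rightarrow> complex ^ 'p ^ 'p \<Rightarrow>
   'p stop_condition set \<Rightarrow> 'p reset_condition set \<Rightarrow> 'p mp_state \<Rightarrow> 'p mp_state \<Rightarrow> bool"
  for D x H Stop Reset where
  begin_pass:
    "mp_step D x H Stop Reset s
       (s\<lparr>in_pass := True,
          rho := (rho s)(steps s := adjoint_matrix D *v r_out D x s)\<rparr>)"
    if "\<not> in_pass s" "\<forall>C\<in>Stop. \<not> C s"
| select:
    "mp_step D x H Stop Reset s
       (s\<lparr>steps := Suc (steps s),
          sel := (sel s)(Suc (steps s) := p),
          coeff := (coeff s)(Suc (steps s) :=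
            coeff s (steps s) + (rho s (steps s) $ p) *s axis p 1),
          rho := (rho s)(Suc (steps s) :=
            rho s (steps s) - (rho s (steps s) $ p) *s column p H)\<rparr>)"
    if "in_pass s" "maximizes s p" "\<forall>C\<in>Reset. \<not> C s p"
| reset:
    "mp_step D x H Stop Reset s (s\<lparr>in_pass := False, reset_at := steps s\<rparr>)"
    if "in_pass s" "maximizes s p" "\<exists>C\<in>Reset. C s p"

definition mp_reachable ::
  "complex ^ 'p ^ 'l \<Rightarrow> complex ^ 'l \<Rightarrow> complex ^ 'p ^ 'p \<Rightarrow>
   'p stop_condition set \<Rightarrow> 'p reset_condition set \<Rightarrow> 'p mp_state \<Rightarrow> bool" where
  "mp_reachable D x H Stop Reset s \<longleftrightarrow> (mp_step D x H Stop Reset)\<^sup>*\<^sup>* mp_init s"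

definition mp_terminated :: "'p stop_condition set \<Rightarrow> ('p::finite) mp_state \<Rightarrow> bool" where
  "mp_terminated Stop s \<longleftrightarrow> \<not> in_pass s \<and> (\<exists>C\<in>Stop. C s)"

text \<open>Every execution is finite, and none gets stuck in a state other than a terminated one.\<close>

definition mp_terminates ::
  "complex ^ 'p ^ 'l \<Rightarrow> complex ^ 'l \<Rightarrow> complex ^ 'p ^ 'p \<Rightarrow>
   'p stop_condition set \<Rightarrow> 'p reset_condition set \<Rightarrow> bool" where
  "mp_terminates D x H Stop Reset \<longleftrightarrow>
     (\<nexists>\<sigma>. \<sigma> 0 = mp_init \<and> (\<forall>n::nat. mp_step D x H Stop Reset (\<sigma> n) (\<sigma> (Suc n)))) \<and>
     (\<forall>s. mp_reachable D x H Stop Reset s \<longrightarrow> (\<nexists>s'. mp_step D x H Stop Reset s s') \<longrightarrow>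
        mp_terminated Stop s)"

definition error_stop ::
  "complex ^ 'p ^ 'l \<Rightarrow> complex ^ 'l \<Rightarrow> real \<Rightarrow> 'p stop_condition" where
  "error_stop D x E s \<longleftrightarrow> E_out D x s \<le> E * (norm x)\<^sup>2"

definition contraction :: "complex ^ 'p ^ 'l \<Rightarrow> real \<Rightarrow> real \<Rightarrow> real" where
  "contraction D \<delta> \<eta> = 1 - \<eta> * (1 + \<delta>) powi (-2) * lambda_min D"

definition drift_reset :: "real \<Rightarrow> real \<Rightarrow> ('p::finite) reset_condition" where
  "drift_reset \<epsilon> \<delta> s p \<longleftrightarrow>
     cmod (rho s (steps s) $ p) <
       \<epsilon> / \<delta> * (\<Sum>l = reset_at s + 1..steps s. cmod (rho s (l - 1) $ sel s l))"

definition size_reset ::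
  "complex ^ 'p ^ 'l \<Rightarrow> complex ^ 'l \<Rightarrow> real \<Rightarrow> real \<Rightarrow> 'p reset_condition" where
  "size_reset D x \<delta> \<eta> s p \<longleftrightarrow>
     cmod (rho s (steps s) $ p) <
       2 * \<delta> * contraction D \<delta> \<eta> powr ((real (reset_at s) - real (steps s)) / 2)
         / (1 - (2 * \<delta> + \<eta>)) * norm (r_out D x s)"

definition count_reset ::
  "complex ^ 'p ^ 'l \<Rightarrow> real \<Rightarrow> real \<Rightarrow> real \<Rightarrow> 'p reset_condition" where
  "count_reset D \<delta> \<eta> E s p \<longleftrightarrow> real (steps s) > ln E / ln (contraction D \<delta> \<eta>)"

end

theory Submission
  imports Defs
begin

text \<open>
  The drift condition makes every selection step contract the true residual. Truncation replaces each entry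
  of the Gram matrix by one at distance at most \<open>\<epsilon>\<close>, so within a pass the coefficient-domain
  residual \<open>\<rho>\<close> departs from \<open>D* r\<close> by at most \<open>\<epsilon>\<close> times the sum of the
  moduli of the coefficients selected so far (lemma \<open>mp_invariant_step\<close>). As long as the drift condition
  does not fire, this is at most \<open>\<delta> |\<rho>(p)|\<close>, where \<open>p\<close> is the selected index. Then \<open>\<rho>(p)\<close> is
  close to the optimal coefficient of the atom \<open>d_p\<close>, so the step lowers \<open>\<parallel>r\<parallel>\<^sup>2\<close> by at least
  \<open>(1 - 2\<delta>) |\<rho>(p)|\<^sup>2\<close>; and \<open>p\<close> is a nearly optimal choice, so
  \<open>(1 + \<delta>) |\<rho>(p)| \<ge> sqrt \<lambda>_min \<parallel>r\<parallel>\<close>. Hence each selection step multiplies \<open>\<parallel>r\<parallel>\<^sup>2\<close> by at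
  most \<open>1 - \<eta> (1 + \<delta>)\<^sup>-\<^sup>2 \<lambda>_min\<close> (lemma \<open>inexact_selection_contracts\<close>), whatever the
  resets do in between.

  After \<open>k\<close> selection steps \<open>\<parallel>r\<^sub>k\<parallel>\<^sup>2\<close> is thus bounded by the \<open>k\<close>-th power of this factor times
  \<open>\<parallel>x\<parallel>\<^sup>2\<close>. Once the counter exceeds the bound of the third reset condition, the target accuracy
  has been reached, so the next reset ends the algorithm. Before that, every pass performs a
  selection step: at the start of a pass \<open>\<rho> = D* r\<close> is exact, the drift sum is empty, and the
  assumption \<open>2\<delta> / (1 - (2\<delta> + \<eta>)) < sqrt \<lambda>_min\<close> ensures that the size condition fails
  (lemma \<open>fresh_pass_does_not_reset\<close>). So there are finitely many selection steps, and at
  most one reset between two of them.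
\<close>

section \<open>Inner products with the atoms\<close>

lemma Re_cinner: "Re (cinner x y) = inner x y"
  by (simp add: cinner_def inner_vec_def inner_complex_def)

lemma norm_cinner_le: "cmod (cinner x y) \<le> norm x * norm y"
proof -
  have "cmod (cinner x y) \<le> (\<Sum>l\<in>UNIV. \<bar>cmod (x $ l)\<bar> * \<bar>cmod (y $ l)\<bar>)"
    unfolding cinner_def by (rule order_trans[OF norm_sum]) (simp add: norm_mult)
  also have "\<dots> \<le> norm x * norm y"
    unfolding norm_vec_def by (rule L2_set_mult_ineq)
  finally show ?thesis .
qed

lemma cinner_diff_left: "cinner (x - y) z = cinner x z - cinner y z"
  by (simp add: cinner_def sum_subtractf algebra_simps)

lemma cinner_scale_left: "cinner (a *s x) z = a * cinner x z"
  by (simp add: cinner_def sum_distrib_left algebra_simps)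

lemma norm_scale_vec: "norm (a *s (x :: complex ^ 'l)) = cmod a * norm x"
  by (simp add: norm_vec_def norm_mult L2_set_right_distrib)

lemma cinner_scale_right: "cinner x (a *s z) = cnj a * cinner x z"
  by (simp add: cinner_def sum_distrib_left algebra_simps)

lemma adjoint_matrix_mult_nth: "(adjoint_matrix D *v y) $ p = cinner y (column p D)"
  by (simp add: adjoint_matrix_def matrix_vector_mult_def cinner_def column_def mult.commute)

lemma gram_nth: "gram D $ k $ j = cinner (column j D) (column k D)"
  by (simp add: gram_def adjoint_matrix_def matrix_matrix_mult_def cinner_def column_def
      mult.commute)

lemma norm_gram_diff_truncated_le:
  "\<epsilon> > 0 \<Longrightarrow> cmod (gram D $ k $ j - truncated_gram \<epsilon> D $ k $ j) \<le> \<epsilon>"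
  by (simp add: truncated_gram_def)

lemma matrix_mult_axis: "D *v axis p 1 = column p (D :: complex ^ 'p ^ 'l)"
  by (simp add: vec_eq_iff matrix_vector_mult_def column_def axis_def if_distrib cong: if_cong)

lemma residual_add_atom:
  "x - D *v (c + a *s axis p 1) = x - D *v c - a *s column p (D :: complex ^ 'p ^ 'l)"
  by (simp add: matrix_vector_right_distrib vector_scalar_commute matrix_mult_axis)

lemma norm_diff_atom_squared:
  assumes "norm d = 1"
  shows "(norm (r - a *s d))\<^sup>2 = (norm r)\<^sup>2 - 2 * Re (cnj a * cinner r d) + (cmod a)\<^sup>2"
proof -
  have "inner r (a *s d) = Re (cnj a * cinner r d)"
    by (simp only: Re_cinner[symmetric] cinner_scale_right)
  moreover have "(norm (r - a *s d))\<^sup>2 = (norm r)\<^sup>2 - 2 * inner r (a *s d) + (norm (a *s d))\<^sup>2"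
    by (simp only: power2_norm_eq_inner) (simp add: inner_diff inner_commute)
  ultimately show ?thesis
    using assms by (simp add: norm_scale_vec)
qed

section \<open>One selection step\<close>

lemma lambda_min_le_unit:
  assumes "norm y = 1"
  shows "lambda_min D \<le> Max (range (\<lambda>p. (cmod (cinner y (column p D)))\<^sup>2))"
  unfolding lambda_min_def
proof (rule cINF_lower)
  show "bdd_below ((\<lambda>y. Max (range (\<lambda>p. (cmod (cinner y (column p D)))\<^sup>2))) ` {y. norm y = 1})"
  proof (rule bdd_belowI2[where m = 0])
    fix y
    have "0 \<le> (cmod (cinner y (column undefined D)))\<^sup>2" by simp
    also have "\<dots> \<le> Max (range (\<lambda>p. (cmod (cinner y (column p D)))\<^sup>2))" by (rule Max_ge) auto
    finally show "0 \<le> Max (range (\<lambda>p. (cmod (cinner y (column p D)))\<^sup>2))" .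
  qed
qed (use assms in simp)

lemma lambda_min_attained:
  obtains q where "lambda_min D * (norm y)\<^sup>2 \<le> (cmod (cinner y (column q D)))\<^sup>2"
proof (cases "y = 0")
  case True
  then show ?thesis using that by simp
next
  case False
  define u where "u = complex_of_real (inverse (norm y)) *s y"
  have "norm u = 1"
    using False by (simp add: u_def norm_scale_vec norm_inverse)
  have "Max (range (\<lambda>p. (cmod (cinner u (column p D)))\<^sup>2))
      \<in> range (\<lambda>p. (cmod (cinner u (column p D)))\<^sup>2)"
    by (rule Max_in) auto
  then obtain q where "lambda_min D \<le> (cmod (cinner u (column q D)))\<^sup>2"
    using lambda_min_le_unit[OF \<open>norm u = 1\<close>, of D] by (metis (no_types, lifting) imageE)
  also have "\<dots> = (cmod (cinner y (column q D)))\<^sup>2 / (norm y)\<^sup>2"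
    by (simp add: u_def cinner_scale_left norm_mult norm_inverse power_mult_distrib
        power_inverse divide_inverse)
  finally show ?thesis
    using that False by (simp add: field_simps)
qed

lemma lambda_min_le_1:
  assumes normalized: "\<And>p. norm (column p D) = 1"
  shows "lambda_min D \<le> 1"
proof -
  \<comment> \<open>An atom is itself a unit vector; any index serves.\<close>
  have unit: "norm (column undefined D) = 1" by (rule normalized)
  obtain q where
    "lambda_min D * (norm (column undefined D))\<^sup>2
      \<le> (cmod (cinner (column undefined D) (column q D)))\<^sup>2"
    by (rule lambda_min_attained)
  also have "\<dots> \<le> 1"
    using norm_cinner_le[of "column undefined D" "column q D"] by (simp add: normalized power_le_one)
  finally show ?thesis using unit by simp
qed

lemma contraction_bounds:
  assumes normalized: "\<And>p. norm (column p D) = 1" and "lambda_min D > 0"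
    and "0 < \<delta>" and "0 < \<eta>" "\<eta> < 1"
  shows "0 < contraction D \<delta> \<eta>" "contraction D \<delta> \<eta> < 1"
proof -
  have "lambda_min D \<le> 1" using normalized by (rule lambda_min_le_1)
  have "0 < (1 + \<delta>) powi (-2)" "(1 + \<delta>) powi (-2) \<le> 1"
    using \<open>0 < \<delta>\<close> by (auto simp: power_int_minus power_inverse[symmetric] power_le_one inverse_le_1_iff)
  then have "\<eta> * (1 + \<delta>) powi (-2) * lambda_min D \<le> \<eta> * 1 * 1"
    using assms \<open>lambda_min D \<le> 1\<close> by (intro mult_mono) auto
  moreover have "0 < \<eta> * (1 + \<delta>) powi (-2) * lambda_min D"
    using assms \<open>0 < (1 + \<delta>) powi (-2)\<close> by simp
  ultimately show "0 < contraction D \<delta> \<eta>" "contraction D \<delta> \<eta> < 1"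
    using \<open>\<eta> < 1\<close> by (auto simp: contraction_def)
qed

text \<open>
  Writing \<open>r\<close> for the true residual, \<open>a = \<rho>(p)\<close> and \<open>\<langle>r, d_p\<rangle> = a + e\<close>, the squared norm changes by
  \<open>- |a|\<^sup>2 - 2 Re (cnj a * e)\<close>. The relative error bound \<open>|e| \<le> \<delta> |a|\<close> makes this a decrease by at
  least \<open>(1 - 2\<delta>) |a|\<^sup>2\<close>. The same bound at the index where \<open>|\<langle>r, d_q\<rangle>|\<close> is largest shows that
  maximizing \<open>\<rho>\<close> instead of \<open>D* r\<close> costs only a factor \<open>1 + \<delta>\<close>.
\<close>

lemma inexact_selection_contracts:
  assumes unit: "norm (column p D) = 1"
    and approx: "\<And>q. cmod (cinner r (column q D) - \<rho> $ q) \<le> \<delta> * cmod (\<rho> $ p)"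
    and maximal: "\<And>q. cmod (\<rho> $ q) \<le> cmod (\<rho> $ p)"
    and "0 < \<delta>" "0 < \<eta>" "\<eta> < 1 - 2 * \<delta>"
  shows "(norm (r - \<rho> $ p *s column p D))\<^sup>2 \<le> contraction D \<delta> \<eta> * (norm r)\<^sup>2"
proof -
  define a where "a = \<rho> $ p"
  define e where "e = cinner r (column p D) - a"
  obtain q where q: "lambda_min D * (norm r)\<^sup>2 \<le> (cmod (cinner r (column q D)))\<^sup>2"
    by (rule lambda_min_attained)
  have "cmod (cinner r (column q D)) \<le> cmod (\<rho> $ q) + cmod (cinner r (column q D) - \<rho> $ q)"
    by (rule norm_triangle_sub)
  also have "\<dots> \<le> (1 + \<delta>) * cmod a"
    using approx[of q] maximal[of q] by (simp add: a_def algebra_simps)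
  finally have "(cmod (cinner r (column q D)))\<^sup>2 \<le> ((1 + \<delta>) * cmod a)\<^sup>2"
    by (simp add: power_mono)
  with q have "lambda_min D * (norm r)\<^sup>2 \<le> (1 + \<delta>)\<^sup>2 * (cmod a)\<^sup>2"
    by (simp add: power_mult_distrib)
  then have "(1 + \<delta>) powi (-2) * (lambda_min D * (norm r)\<^sup>2)
      \<le> (1 + \<delta>) powi (-2) * ((1 + \<delta>)\<^sup>2 * (cmod a)\<^sup>2)"
    using \<open>0 < \<delta>\<close> by (intro mult_left_mono) auto
  also have "\<dots> = (cmod a)\<^sup>2"
    using \<open>0 < \<delta>\<close> by (simp add: power_int_minus)
  finally have "\<eta> * ((1 + \<delta>) powi (-2) * (lambda_min D * (norm r)\<^sup>2)) \<le> \<eta> * (cmod a)\<^sup>2"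
    using \<open>0 < \<eta>\<close> by simp
  also have "\<dots> \<le> (1 - 2 * \<delta>) * (cmod a)\<^sup>2"
    using \<open>\<eta> < 1 - 2 * \<delta>\<close> by (intro mult_right_mono) auto
  finally have gain: "\<eta> * (1 + \<delta>) powi (-2) * lambda_min D * (norm r)\<^sup>2 \<le> (1 - 2 * \<delta>) * (cmod a)\<^sup>2"
    by (simp add: mult.assoc)
  have "cnj a * a = complex_of_real ((cmod a)\<^sup>2)"
    by (subst mult.commute) (rule complex_norm_square[symmetric])
  then have cross: "Re (cnj a * cinner r (column p D)) = (cmod a)\<^sup>2 + Re (cnj a * e)"
    by (simp add: e_def right_diff_distrib del: complex_cnj_mult times_complex.simps)
  have "- Re (cnj a * e) \<le> cmod (cnj a * e)"
    using abs_Re_le_cmod[of "cnj a * e"] by linarith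
  also have "\<dots> \<le> cmod a * (\<delta> * cmod a)"
    using approx[of p] by (simp add: norm_mult e_def a_def mult_left_mono)
  also have "\<dots> = \<delta> * (cmod a)\<^sup>2" by (simp add: power2_eq_square)
  finally have error: "- Re (cnj a * e) \<le> \<delta> * (cmod a)\<^sup>2" .
  have "(norm (r - a *s column p D))\<^sup>2 \<le> (norm r)\<^sup>2 - (1 - 2 * \<delta>) * (cmod a)\<^sup>2"
    unfolding norm_diff_atom_squared[OF unit] cross using error by (simp add: algebra_simps)
  also have "\<dots> \<le> contraction D \<delta> \<eta> * (norm r)\<^sup>2"
    using gain by (simp add: contraction_def algebra_simps)
  finally show ?thesis by (simp add: a_def)
qed

section \<open>Invariants of the runs\<close>

definition drift :: "('p::finite) mp_state \<Rightarrow> real" where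
  "drift s = (\<Sum>l = reset_at s + 1..steps s. cmod (rho s (l - 1) $ sel s l))"

lemma drift_reset_iff: "drift_reset \<epsilon> \<delta> s p \<longleftrightarrow> cmod (rho s (steps s) $ p) < \<epsilon> / \<delta> * drift s"
  by (simp add: drift_reset_def drift_def)

abbreviation residual :: "complex ^ 'p ^ 'l \<Rightarrow> complex ^ 'l \<Rightarrow> 'p mp_state \<Rightarrow> nat \<Rightarrow> complex ^ 'l" where
  "residual D x s k \<equiv> x - D *v coeff s k"

locale truncated_pursuit =
  fixes D :: "complex ^ 'p ^ 'l"
    and x :: "complex ^ 'l"
    and \<epsilon> \<delta> \<eta> E :: real
    and Stop :: "'p stop_condition set"
    and Reset :: "'p reset_condition set"
  assumes normalized: "norm (column p D) = 1"
    and lambda_pos: "lambda_min D > 0"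
    and eps: "\<epsilon> > 0"
    and delta: "0 < \<delta>"
    and eta: "0 < \<eta>" "\<eta> < 1 - 2 * \<delta>"
    and small: "2 * \<delta> / (1 - (2 * \<delta> + \<eta>)) < sqrt (lambda_min D)"
    and E_pos: "0 < E"
    and stop: "error_stop D x E \<in> Stop"
    and reset: "drift_reset \<epsilon> \<delta> \<in> Reset" "size_reset D x \<delta> \<eta> \<in> Reset"
      "count_reset D \<delta> \<eta> E \<in> Reset"
    and other_resets: "\<And>C s p.
      C \<in> Reset - {drift_reset \<epsilon> \<delta>, size_reset D x \<delta> \<eta>, count_reset D \<delta> \<eta> E} \<Longrightarrow>
      mp_reachable D x (truncated_gram \<epsilon> D) Stop Reset s \<Longrightarrow>
      in_pass s \<Longrightarrow> steps s = reset_at s \<Longrightarrow> maximizes s p \<Longrightarrow> \<not> C s p"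
begin

abbreviation (input) step :: "'p mp_state \<Rightarrow> 'p mp_state \<Rightarrow> bool" where
  "step \<equiv> mp_step D x (truncated_gram \<epsilon> D) Stop Reset"

abbreviation (input) reachable :: "'p mp_state \<Rightarrow> bool" where
  "reachable \<equiv> mp_reachable D x (truncated_gram \<epsilon> D) Stop Reset"

lemma contraction_pos: "0 < contraction D \<delta> \<eta>"
  and contraction_less_1: "contraction D \<delta> \<eta> < 1"
  using contraction_bounds[OF normalized lambda_pos delta eta(1)] eta delta by auto

text \<open>
  The third component bounds the deviation of \<open>rho\<close> from the exact coefficient-domain
  residual; at the start of a pass the bound is zero, which says that \<open>rho\<close> is exact. The last one
  records that a pass starts only when the accuracy has not been reached, and \<open>E_out\<close> stays
  the same throughout the pass.
\<close>

definition mp_invariant :: "'p mp_state \<Rightarrow> bool" where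
  "mp_invariant s \<longleftrightarrow>
     reset_at s \<le> steps s \<and>
     (norm (residual D x s (steps s)))\<^sup>2 \<le> contraction D \<delta> \<eta> ^ steps s * (norm x)\<^sup>2 \<and>
     (in_pass s \<longrightarrow> (\<forall>q. cmod (cinner (residual D x s (steps s)) (column q D) - rho s (steps s) $ q)
        \<le> \<epsilon> * drift s)) \<and>
     (\<not> in_pass s \<longrightarrow> steps s = reset_at s) \<and>
     (in_pass s \<longrightarrow> E * (norm x)\<^sup>2 < E_out D x s)"

lemma mp_invariant_init: "mp_invariant mp_init"
  by (simp add: mp_invariant_def mp_init_def)

lemma mp_invariant_step:
  assumes "step s s'" and inv: "mp_invariant s"
  shows "mp_invariant s'"
  using assms(1)
proof cases
  case begin_pass
  then have fresh: "steps s = reset_at s" using inv by (simp add: mp_invariant_def)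
  have "\<not> error_stop D x E s" using begin_pass stop by blast
  then show ?thesis
    using inv eps begin_pass fresh
    by (simp add: mp_invariant_def adjoint_matrix_mult_nth r_out_def drift_def E_out_def
        error_stop_def not_le)
next
  case (select p)
  let ?k = "steps s" and ?a = "rho s (steps s) $ p" and ?r = "residual D x s (steps s)"
  have le: "reset_at s \<le> ?k" using inv by (simp add: mp_invariant_def)
  have dev: "cmod (cinner ?r (column q D) - rho s ?k $ q) \<le> \<epsilon> * drift s" for q
    using inv select by (simp add: mp_invariant_def)
  have res': "residual D x s' (Suc ?k) = ?r - ?a *s column p D"
    using select by (simp add: residual_add_atom)
  have "\<not> drift_reset \<epsilon> \<delta> s p" using select reset by blast
  then have "\<epsilon> * drift s \<le> \<delta> * cmod ?a"
    using delta by (simp add: drift_reset_iff field_simps not_less)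
  then have "cmod (cinner ?r (column q D) - rho s ?k $ q) \<le> \<delta> * cmod ?a" for q
    using dev[of q] by simp
  moreover have "cmod (rho s ?k $ q) \<le> cmod ?a" for q
    using select by (simp add: maximizes_def is_arg_max_linorder)
  ultimately have "(norm (?r - ?a *s column p D))\<^sup>2 \<le> contraction D \<delta> \<eta> * (norm ?r)\<^sup>2"
    using normalized delta eta by (intro inexact_selection_contracts) auto
  also have "\<dots> \<le> contraction D \<delta> \<eta> * (contraction D \<delta> \<eta> ^ ?k * (norm x)\<^sup>2)"
    using inv contraction_pos by (intro mult_left_mono) (auto simp: mp_invariant_def)
  finally have decay:
    "(norm (residual D x s' (Suc ?k)))\<^sup>2 \<le> contraction D \<delta> \<eta> ^ Suc ?k * (norm x)\<^sup>2"
    unfolding res' by (simp add: mult.assoc)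
  have "drift s' = (\<Sum>l = reset_at s + 1..?k. cmod (rho s' (l - 1) $ sel s' l)) + cmod ?a"
    using le select by (simp add: drift_def)
  also have "(\<Sum>l = reset_at s + 1..?k. cmod (rho s' (l - 1) $ sel s' l)) = drift s"
    unfolding drift_def using select by (intro sum.cong) auto
  finally have drift': "drift s' = drift s + cmod ?a" .
  \<comment> \<open>The exact update subtracts a column of \<open>gram D\<close>, the performed one a column of its truncation.\<close>
  have dev': "cmod (cinner (residual D x s' (Suc ?k)) (column q D) - rho s' (Suc ?k) $ q)
      \<le> \<epsilon> * drift s'" for q
  proof -
    have "rho s' (Suc ?k) $ q = rho s ?k $ q - ?a * truncated_gram \<epsilon> D $ q $ p"
      using select by (simp add: column_def)
    then have "cinner (residual D x s' (Suc ?k)) (column q D) - rho s' (Suc ?k) $ q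
        = (cinner ?r (column q D) - rho s ?k $ q)
          - ?a * (gram D $ q $ p - truncated_gram \<epsilon> D $ q $ p)"
      unfolding res'
      by (simp only: cinner_diff_left cinner_scale_left gram_nth) (simp add: algebra_simps)
    also have "cmod \<dots> \<le> cmod (cinner ?r (column q D) - rho s ?k $ q)
        + cmod ?a * cmod (gram D $ q $ p - truncated_gram \<epsilon> D $ q $ p)"
      by (rule order_trans[OF norm_triangle_ineq4]) (simp add: norm_mult)
    also have "\<dots> \<le> \<epsilon> * drift s + cmod ?a * \<epsilon>"
      using dev[of q] norm_gram_diff_truncated_le[OF eps, of D q p]
      by (intro add_mono mult_left_mono) auto
    finally show ?thesis by (simp add: drift' algebra_simps)
  qed
  have "steps s' = Suc ?k" "in_pass s'" "reset_at s' = reset_at s"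
    using select by auto
  moreover have "E_out D x s' = E_out D x s"
    using le select by (simp add: E_out_def r_out_def)
  moreover have "E * (norm x)\<^sup>2 < E_out D x s" using inv select by (simp add: mp_invariant_def)
  ultimately show ?thesis
    using decay dev' le unfolding mp_invariant_def by simp
next
  case (reset p)
  then show ?thesis using inv by (simp add: mp_invariant_def)
qed

lemma mp_invariant_reachable:
  assumes "reachable s"
  shows "mp_invariant s"
  using assms unfolding mp_reachable_def
  by (induction rule: rtranclp_induct) (auto intro: mp_invariant_init mp_invariant_step)

section \<open>Termination\<close>

lemma accurate_after_count:
  assumes inv: "mp_invariant s" and fresh: "steps s = reset_at s"
    and count: "real (steps s) > ln E / ln (contraction D \<delta> \<eta>)"
  shows "E_out D x s \<le> E * (norm x)\<^sup>2"
proof -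
  have "ln (contraction D \<delta> \<eta>) < 0"
    using contraction_pos contraction_less_1 by simp
  then have "real (steps s) * ln (contraction D \<delta> \<eta>) < ln E"
    using count by (simp add: field_simps)
  then have "ln (contraction D \<delta> \<eta> ^ steps s) < ln E"
    using contraction_pos by (simp add: ln_realpow)
  then have "contraction D \<delta> \<eta> ^ steps s < E"
    using contraction_pos E_pos by (subst (asm) ln_less_cancel_iff) auto
  then have "contraction D \<delta> \<eta> ^ steps s * (norm x)\<^sup>2 \<le> E * (norm x)\<^sup>2"
    by (intro mult_right_mono) auto
  then show ?thesis
    using inv fresh by (simp add: mp_invariant_def E_out_def r_out_def)
qed

text \<open>
  At this point \<open>\<rho>\<close> is exact, so its largest entry has modulus at least
  \<open>sqrt \<lambda>_min \<parallel>r_out\<parallel>\<close>, which exceeds the threshold of the size condition; the drift condition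
  compares with an empty sum; and the count condition would mean that the accuracy had been reached
  before the pass began.
\<close>

lemma fresh_pass_does_not_reset:
  assumes reach: "reachable s" and "in_pass s" "maximizes s p" and fresh: "steps s = reset_at s"
    and "C \<in> Reset"
  shows "\<not> C s p"
proof -
  have inv: "mp_invariant s" using reach by (rule mp_invariant_reachable)
  have "drift s = 0" using fresh by (simp add: drift_def)
  then have no_drift: "\<not> drift_reset \<epsilon> \<delta> s p"
    by (simp add: drift_reset_iff)
  have exact: "rho s (steps s) $ q = cinner (r_out D x s) (column q D)" for q
    using inv \<open>in_pass s\<close> \<open>drift s = 0\<close> fresh by (simp add: mp_invariant_def r_out_def)
  obtain q where
    "lambda_min D * (norm (r_out D x s))\<^sup>2 \<le> (cmod (cinner (r_out D x s) (column q D)))\<^sup>2"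
    by (rule lambda_min_attained)
  also have "\<dots> \<le> (cmod (rho s (steps s) $ p))\<^sup>2"
    using \<open>maximizes s p\<close>
    by (auto simp: exact[symmetric] maximizes_def is_arg_max_linorder intro: power_mono)
  finally have "(sqrt (lambda_min D) * norm (r_out D x s))\<^sup>2 \<le> (cmod (rho s (steps s) $ p))\<^sup>2"
    using lambda_pos by (simp add: power_mult_distrib)
  then have large: "sqrt (lambda_min D) * norm (r_out D x s) \<le> cmod (rho s (steps s) $ p)"
    by (rule power2_le_imp_le) simp
  have "2 * \<delta> / (1 - (2 * \<delta> + \<eta>)) * norm (r_out D x s) \<le> sqrt (lambda_min D) * norm (r_out D x s)"
    using small by (intro mult_right_mono) auto
  also note large
  finally have no_size: "\<not> size_reset D x \<delta> \<eta> s p"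
    using fresh contraction_pos by (simp add: size_reset_def)
  have no_count: "\<not> count_reset D \<delta> \<eta> E s p"
    using accurate_after_count[OF inv fresh] inv \<open>in_pass s\<close>
    by (auto simp: count_reset_def mp_invariant_def)
  show ?thesis
    using no_drift no_size no_count other_resets[OF _ reach \<open>in_pass s\<close> fresh \<open>maximizes s p\<close>]
      \<open>C \<in> Reset\<close> by blast
qed

definition max_steps :: nat where
  "max_steps = Suc (nat \<lfloor>ln E / ln (contraction D \<delta> \<eta>)\<rfloor>)"

text \<open>
  Each selection step uses up one of the finitely many that the count condition permits, worth three
  units. The remaining units order the phases between two selection steps: a pass with
  selections, then the head of the outer loop, then a fresh pass, which must select next.
\<close>

definition run_measure :: "'p mp_state \<Rightarrow> nat" where
  "run_measure s = 3 * (max_steps - steps s)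
     + (if in_pass s then if steps s = reset_at s then 0 else 2 else 1)"

lemma run_measure_decreases:
  assumes reach: "reachable s" and "step s s'"
  shows "run_measure s' < run_measure s"
  using assms(2)
proof cases
  case begin_pass
  then show ?thesis
    using mp_invariant_reachable[OF reach] by (simp add: run_measure_def mp_invariant_def)
next
  case (select p)
  then have "\<not> count_reset D \<delta> \<eta> E s p" using reset by blast
  then have "real (steps s) \<le> ln E / ln (contraction D \<delta> \<eta>)"
    by (simp add: count_reset_def)
  then have "steps s < max_steps"
    by (simp add: max_steps_def less_Suc_eq_le le_nat_floor)
  then have "max_steps - steps s = Suc (max_steps - Suc (steps s))" by simp
  then show ?thesis using select by (simp add: run_measure_def)
next
  case (reset p)
  then have "steps s \<noteq> reset_at s"
    using fresh_pass_does_not_reset[OF reach] by blast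
  then show ?thesis using reset by (simp add: run_measure_def)
qed

lemma no_infinite_run:
  "\<nexists>\<sigma>. \<sigma> 0 = mp_init \<and> (\<forall>n::nat. step (\<sigma> n) (\<sigma> (Suc n)))"
proof
  assume "\<exists>\<sigma>. \<sigma> 0 = mp_init \<and> (\<forall>n::nat. step (\<sigma> n) (\<sigma> (Suc n)))"
  then obtain \<sigma> where "\<sigma> 0 = mp_init" and steps: "\<And>n::nat. step (\<sigma> n) (\<sigma> (Suc n))"
    by blast
  have "reachable (\<sigma> n)" for n
  proof (induction n)
    case 0
    then show ?case using \<open>\<sigma> 0 = mp_init\<close> by (simp add: mp_reachable_def)
  next
    case (Suc n)
    then show ?case
      using steps[of n] unfolding mp_reachable_def by (rule rtranclp.rtrancl_into_rtrancl)
  qed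
  then have "(\<sigma> (Suc n), \<sigma> n) \<in> inv_image less_than run_measure" for n
    using run_measure_decreases steps by simp
  then show False
    using wf_inv_image[OF wf_less_than, of run_measure] unfolding wf_iff_no_infinite_down_chain by blast
qed

end

lemma maximizer_exists: "\<exists>p. maximizes s p"
proof -
  let ?f = "\<lambda>q. cmod (rho s (steps s) $ q)"
  have "Max (range ?f) \<in> range ?f" by (rule Max_in) auto
  then obtain p where "?f p = Max (range ?f)" by force
  then have "?f q \<le> ?f p" for q by simp
  then show ?thesis by (auto simp: maximizes_def is_arg_max_linorder)
qed

lemma stuck_imp_terminated:
  assumes "\<nexists>s'. mp_step D x H Stop Reset s s'"
  shows "mp_terminated Stop s"
proof (cases "in_pass s")
  case True
  obtain p where "maximizes s p" using maximizer_exists by blast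
  then show ?thesis using assms mp_step.select mp_step.reset True by metis
next
  case False
  then show ?thesis
    using assms mp_step.begin_pass unfolding mp_terminated_def by metis
qed

lemma norm_complex_vec: "norm (complex_vec x) = norm x"
  by (simp add: norm_vec_def complex_vec_def L2_set_def)

theorem corollary3:
  fixes D :: "complex ^ 'p ^ 'l"
    and x :: "real ^ 'l"
    and \<epsilon> \<delta> \<eta> E :: real
    and Stop :: "'p stop_condition set"
    and Reset :: "'p reset_condition set"
  assumes normalized: "\<And>p. norm (column p D) = 1"
    and spanning: "vec.span (range (\<lambda>p. column p D)) = UNIV"
    and lambda_pos: "lambda_min D > 0"
    and eps: "\<epsilon> > 0"
    and delta: "0 < \<delta>" "\<delta> < 1 / 2"
    and eta: "0 < \<eta>" "\<eta> < 1 - 2 * \<delta>"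
    and small: "2 * \<delta> / (1 - (2 * \<delta> + \<eta>)) < sqrt (lambda_min D)"
    and E: "0 < E" "E < 1"
    and stop: "error_stop D (complex_vec x) E \<in> Stop"
    and reset: "drift_reset \<epsilon> \<delta> \<in> Reset" "size_reset D (complex_vec x) \<delta> \<eta> \<in> Reset"
      "count_reset D \<delta> \<eta> E \<in> Reset"
    and other_resets: "\<And>C s p.
      C \<in> Reset - {drift_reset \<epsilon> \<delta>, size_reset D (complex_vec x) \<delta> \<eta>, count_reset D \<delta> \<eta> E} \<Longrightarrow>
      mp_reachable D (complex_vec x) (truncated_gram \<epsilon> D) Stop Reset s \<Longrightarrow>
      in_pass s \<Longrightarrow> steps s = reset_at s \<Longrightarrow> maximizes s p \<Longrightarrow> \<not> C s p"
  shows "mp_terminates D (complex_vec x) (truncated_gram \<epsilon> D) Stop Reset \<and>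
    (\<forall>s. mp_reachable D (complex_vec x) (truncated_gram \<epsilon> D) Stop Reset s \<longrightarrow>
       mp_terminated Stop s \<longrightarrow>
       (\<forall>C \<in> Stop - {error_stop D (complex_vec x) E}. \<not> C s) \<longrightarrow>
       E_out D (complex_vec x) s \<le> E * (norm x)\<^sup>2)"
proof -
  interpret truncated_pursuit D "complex_vec x" \<epsilon> \<delta> \<eta> E Stop Reset
    using assms by unfold_locales blast+
  have "mp_terminates D (complex_vec x) (truncated_gram \<epsilon> D) Stop Reset"
    unfolding mp_terminates_def
  proof (intro conjI allI impI)
    show "mp_terminated Stop s"
      if "\<nexists>s'. mp_step D (complex_vec x) (truncated_gram \<epsilon> D) Stop Reset s s'" for s
      using that by (rule stuck_imp_terminated)
  qed (rule no_infinite_run)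
  moreover have "E_out D (complex_vec x) s \<le> E * (norm x)\<^sup>2"
    if "mp_terminated Stop s" "\<forall>C \<in> Stop - {error_stop D (complex_vec x) E}. \<not> C s" for s
  proof -
    obtain C where "C \<in> Stop" "C s" using \<open>mp_terminated Stop s\<close> by (auto simp: mp_terminated_def)
    then have "error_stop D (complex_vec x) E s" using that(2) by blast
    then show ?thesis by (simp add: error_stop_def norm_complex_vec)
  qed
  ultimately show ?thesis by blast
qed

end
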